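(* Let $X$ and $Y$ be compact Hausdorff spaces, let $\pi: Y\rightarrow X$ be an irreducible map, and let $\alpha: C(X)\rightarrow C(Y)$ be the $*$-monomorphism dual to $\pi$, that is, $\alpha(f)=f\circ\pi$ for $f\in C(X)$. The following statements hold. (1) The map $\mathrm{Ropen}(Y)\ni U\mapsto \operatorname{int}(\pi(\operatorname{cl}(U)))\in \mathrm{Ropen}(X)$ is an isomorphism of Boolean algebras whose inverse is $\mathrm{Ropen}(X)\ni V\mapsto \operatorname{int}(\operatorname{cl}(\pi^{-1}(V)))\in\mathrm{Ropen}(Y)$. (2) The map $\mathrm{Rideal}(C(X))\ni J\mapsto \alpha(J)^{\perp\perp}\in \mathrm{Rideal}(C(Y))$ is a Boolean algebra isomorphism whose inverse is $\mathrm{Rideal}(C(Y))\ni K\mapsto \alpha^{-1}(K)\in \mathrm{Rideal}(C(X))$.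
   Context: A continuous surjection $\pi:Y\to X$ between compact Hausdorff spaces is irreducible if the only closed subset $F\subseteq Y$ with $\pi(F)=X$ is $F=Y$. $C(X)$ is the C*-algebra of continuous complex-valued functions on $X$. An open set $V\subseteq X$ is regular open if $V=\operatorname{int}(\operatorname{cl}(V))$. $\mathrm{Ropen}(X)$ denotes the complete Boolean algebra of regular open subsets of $X$ with operations $V_1\vee V_2=\operatorname{int}(\operatorname{cl}(V_1\cup V_2))$, $V_1\wedge V_2=V_1\cap V_2$, $\neg V=X\setminus\operatorname{cl}(V)$. For a set $S\subseteq C(X)$, $S^\perp=\{f\in C(X): fg=0 \text{ for every } g\in S\}$ and $S^{\perp\perp}=(S^\perp)^\perp$. An ideal $J$ of $C(X)$ is a regular ideal if $J=J^{\perp\perp}$. $\mathrm{Rideal}(C(X))$ denotes the Boolean algebra of regular ideals of $C(X)$ with operations $\neg J=J^\perp$, $J_1\vee J_2=(J_1\cup J_2)^{\perp\perp}$, $J_1\wedge J_2=J_1\cap J_2$. The same definitions apply with $Y$ in place of $X$. *)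

theory Defs
  imports "HOL-Analysis.Analysis" "HOL-Algebra.Ideal"
begin

section \<open>Boolean algebras on a carrier set\<close>

record 'a bool_alg = "'a partial_object" +
  bmeet :: "'a \<Rightarrow> 'a \<Rightarrow> 'a"
  bjoin :: "'a \<Rightarrow> 'a \<Rightarrow> 'a"
  bcompl :: "'a \<Rightarrow> 'a"
  bzero :: "'a"
  bone :: "'a"

text \<open>The axioms of \<^locale>\<open>abstract_boolean_algebra\<close>, relativised to a carrier set. The one-element
  Boolean algebra is allowed; it occurs for the empty space.\<close>

locale carrier_boolean_algebra =
  fixes B :: "('a, 'z) bool_alg_scheme"
  assumes meet_closed: "\<lbrakk>x \<in> carrier B; y \<in> carrier B\<rbrakk> \<Longrightarrow> bmeet B x y \<in> carrier B"
    and join_closed: "\<lbrakk>x \<in> carrier B; y \<in> carrier B\<rbrakk> \<Longrightarrow> bjoin B x y \<in> carrier B"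
    and compl_closed: "x \<in> carrier B \<Longrightarrow> bcompl B x \<in> carrier B"
    and zero_closed: "bzero B \<in> carrier B"
    and one_closed: "bone B \<in> carrier B"
    and meet_assoc: "\<lbrakk>x \<in> carrier B; y \<in> carrier B; z \<in> carrier B\<rbrakk>
      \<Longrightarrow> bmeet B (bmeet B x y) z = bmeet B x (bmeet B y z)"
    and join_assoc: "\<lbrakk>x \<in> carrier B; y \<in> carrier B; z \<in> carrier B\<rbrakk>
      \<Longrightarrow> bjoin B (bjoin B x y) z = bjoin B x (bjoin B y z)"
    and meet_commute: "\<lbrakk>x \<in> carrier B; y \<in> carrier B\<rbrakk> \<Longrightarrow> bmeet B x y = bmeet B y x"
    and join_commute: "\<lbrakk>x \<in> carrier B; y \<in> carrier B\<rbrakk> \<Longrightarrow> bjoin B x y = bjoin B y x"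
    and meet_join_distrib: "\<lbrakk>x \<in> carrier B; y \<in> carrier B; z \<in> carrier B\<rbrakk>
      \<Longrightarrow> bmeet B x (bjoin B y z) = bjoin B (bmeet B x y) (bmeet B x z)"
    and join_meet_distrib: "\<lbrakk>x \<in> carrier B; y \<in> carrier B; z \<in> carrier B\<rbrakk>
      \<Longrightarrow> bjoin B x (bmeet B y z) = bmeet B (bjoin B x y) (bjoin B x z)"
    and meet_one: "x \<in> carrier B \<Longrightarrow> bmeet B x (bone B) = x"
    and join_zero: "x \<in> carrier B \<Longrightarrow> bjoin B x (bzero B) = x"
    and meet_compl: "x \<in> carrier B \<Longrightarrow> bmeet B x (bcompl B x) = bzero B"
    and join_compl: "x \<in> carrier B \<Longrightarrow> bjoin B x (bcompl B x) = bone B"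

definition bool_alg_iso ::
    "('a, 'y) bool_alg_scheme \<Rightarrow> ('b, 'z) bool_alg_scheme \<Rightarrow> ('a \<Rightarrow> 'b) \<Rightarrow> bool" where
  "bool_alg_iso A B h \<longleftrightarrow>
     carrier_boolean_algebra A \<and> carrier_boolean_algebra B \<and>
     bij_betw h (carrier A) (carrier B) \<and>
     (\<forall>x \<in> carrier A. \<forall>y \<in> carrier A. h (bmeet A x y) = bmeet B (h x) (h y)) \<and>
     (\<forall>x \<in> carrier A. \<forall>y \<in> carrier A. h (bjoin A x y) = bjoin B (h x) (h y)) \<and>
     (\<forall>x \<in> carrier A. h (bcompl A x) = bcompl B (h x)) \<and>
     h (bzero A) = bzero B \<and> h (bone A) = bone B"

definition inverse_between :: "'a set \<Rightarrow> 'b set \<Rightarrow> ('a \<Rightarrow> 'b) \<Rightarrow> ('b \<Rightarrow> 'a) \<Rightarrow> bool" where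
  "inverse_between A B h k \<longleftrightarrow>
     h \<in> A \<rightarrow> B \<and> k \<in> B \<rightarrow> A \<and> (\<forall>a \<in> A. k (h a) = a) \<and> (\<forall>b \<in> B. h (k b) = b)"


section \<open>Irreducible maps and regular open sets\<close>

definition irreducible_map :: "'b topology \<Rightarrow> 'a topology \<Rightarrow> ('b \<Rightarrow> 'a) \<Rightarrow> bool" where
  "irreducible_map Y X \<pi> \<longleftrightarrow>
     continuous_map Y X \<pi> \<and> \<pi> ` topspace Y = topspace X \<and>
     (\<forall>F. closedin Y F \<and> \<pi> ` F = topspace X \<longrightarrow> F = topspace Y)"

definition Ropen :: "'a topology \<Rightarrow> 'a set bool_alg" where
  "Ropen X =
     \<lparr>carrier = {V. openin X V \<and> V = X interior_of (X closure_of V)},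
      bmeet = (\<lambda>V W. V \<inter> W),
      bjoin = (\<lambda>V W. X interior_of (X closure_of (V \<union> W))),
      bcompl = (\<lambda>V. topspace X - X closure_of V),
      bzero = {},
      bone = topspace X\<rparr>"


section \<open>The algebra of continuous functions and its regular ideals\<close>

text \<open>Functions on \<^term>\<open>topspace X\<close> are represented by functions on the whole type that are
  \<^const>\<open>undefined\<close> outside \<^term>\<open>topspace X\<close>, so that equality in the ring is pointwise equality
  on \<^term>\<open>topspace X\<close>. Only the ring structure of $C(X)$ is recorded: since $C(X)$ is unital, its
  ring ideals are automatically complex subspaces, and ideals with $J = J^{\perp\perp}$ are
  automatically norm closed.\<close>

definition Cfun :: "'a topology \<Rightarrow> ('a \<Rightarrow> complex) ring" where
  "Cfun X =
     \<lparr>carrier = {f. continuous_map X euclidean f \<and> f \<in> extensional (topspace X)},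
      mult = (\<lambda>f g. \<lambda>x\<in>topspace X. f x * g x),
      one = (\<lambda>x\<in>topspace X. 1),
      zero = (\<lambda>x\<in>topspace X. 0),
      add = (\<lambda>f g. \<lambda>x\<in>topspace X. f x + g x)\<rparr>"

lemma continuous_map_restrict_topspace:
  "continuous_map X Z (restrict f (topspace X)) \<longleftrightarrow> continuous_map X Z f"
  by (auto intro: continuous_map_eq)

lemma continuous_map_complex_mult:
  fixes f g :: "'a \<Rightarrow> complex"
  shows "\<lbrakk>continuous_map X euclidean f; continuous_map X euclidean g\<rbrakk>
    \<Longrightarrow> continuous_map X euclidean (\<lambda>x. f x * g x)"
  by (simp add: continuous_map_atin tendsto_mult)

text \<open>The locale \<^locale>\<open>ideal\<close> includes the ring axioms, so this fact is what makes
  the ideals of \<^term>\<open>Cfun X\<close> meaningful.\<close>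

lemma cring_Cfun: "cring (Cfun X)"
proof (rule cringI)
  show "abelian_group (Cfun X)"
  proof (rule abelian_groupI)
    fix f assume f: "f \<in> carrier (Cfun X)"
    show "\<exists>g\<in>carrier (Cfun X). g \<oplus>\<^bsub>Cfun X\<^esub> f = \<zero>\<^bsub>Cfun X\<^esub>"
      by (rule bexI[where x = "\<lambda>x\<in>topspace X. - f x"])
        (use f in \<open>auto simp: Cfun_def continuous_map_restrict_topspace fun_eq_iff
           intro!: continuous_map_minus\<close>)
  qed (auto simp: Cfun_def continuous_map_restrict_topspace fun_eq_iff extensional_def
         intro!: continuous_map_add)
  show "comm_monoid (Cfun X)"
    by (rule comm_monoidI)
      (auto simp: Cfun_def continuous_map_restrict_topspace fun_eq_iff extensional_def
         intro!: continuous_map_complex_mult)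
qed (auto simp: Cfun_def fun_eq_iff algebra_simps)

definition annihilator :: "('c, 'z) ring_scheme \<Rightarrow> 'c set \<Rightarrow> 'c set" where
  "annihilator R S = {f \<in> carrier R. \<forall>g \<in> S. f \<otimes>\<^bsub>R\<^esub> g = \<zero>\<^bsub>R\<^esub>}"

definition Rideal :: "('c, 'z) ring_scheme \<Rightarrow> 'c set bool_alg" where
  "Rideal R =
     \<lparr>carrier = {J. ideal J R \<and> J = annihilator R (annihilator R J)},
      bmeet = (\<lambda>J K. J \<inter> K),
      bjoin = (\<lambda>J K. annihilator R (annihilator R (J \<union> K))),
      bcompl = (\<lambda>J. annihilator R J),
      bzero = {\<zero>\<^bsub>R\<^esub>},
      bone = carrier R\<rparr>"

definition dual_map :: "'b topology \<Rightarrow> ('b \<Rightarrow> 'a) \<Rightarrow> ('a \<Rightarrow> complex) \<Rightarrow> 'b \<Rightarrow> complex" where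
  "dual_map Y \<pi> f = restrict (f \<circ> \<pi>) (topspace Y)"

lemma dual_map_ring_hom:
  assumes "continuous_map Y X \<pi>"
  shows "dual_map Y \<pi> \<in> ring_hom (Cfun X) (Cfun Y)"
proof (rule ring_hom_memI)
  have \<pi>: "\<pi> y \<in> topspace X" if "y \<in> topspace Y" for y
    using assms that by (auto simp: continuous_map_def)
  show "dual_map Y \<pi> f \<in> carrier (Cfun Y)" if "f \<in> carrier (Cfun X)" for f
    using that assms continuous_map_compose[of Y X \<pi> euclidean f]
    by (simp add: Cfun_def dual_map_def continuous_map_restrict_topspace)
qed (use assms in \<open>auto simp: Cfun_def dual_map_def fun_eq_iff continuous_map_def Pi_iff\<close>)

lemma dual_map_cnj:
  assumes "continuous_map Y X \<pi>"
  shows "dual_map Y \<pi> (\<lambda>x\<in>topspace X. cnj (f x)) = (\<lambda>y\<in>topspace Y. cnj (dual_map Y \<pi> f y))"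
  using assms by (auto simp: dual_map_def fun_eq_iff continuous_map_def Pi_iff)

lemma inj_on_dual_map:
  assumes "\<pi> ` topspace Y = topspace X"
  shows "inj_on (dual_map Y \<pi>) (carrier (Cfun X))"
proof (rule inj_onI)
  fix f g assume fg: "f \<in> carrier (Cfun X)" "g \<in> carrier (Cfun X)"
    and eq: "dual_map Y \<pi> f = dual_map Y \<pi> g"
  show "f = g"
  proof (rule extensionalityI[where A = "topspace X"])
    fix x assume "x \<in> topspace X"
    then obtain y where y: "y \<in> topspace Y" "x = \<pi> y"
      using assms by blast
    then show "f x = g x"
      using fun_cong[OF eq, of y] by (simp add: dual_map_def)
  qed (use fg in \<open>simp_all add: Cfun_def\<close>)
qed

end

theory Submission
  imports Defs
begin

text \<open>For an open set \<open>U\<close> of \<open>Y\<close> let \<open>\<pi>\<^sub>*U = X - \<pi>(Y - U)\<close>, the largest subset of \<open>X\<close> whose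
  preimage lies in \<open>U\<close>. Since \<open>\<pi>\<close> is closed and irreducible, \<open>\<pi>\<^sub>*U\<close> is open and its preimage is
  dense in \<open>U\<close>. It follows that \<open>\<pi>\<^sub>*U = int (\<pi> (cl U))\<close> when \<open>U\<close> is regular open. The description
  by \<open>\<pi>\<^sub>*\<close> makes it clear that meets are preserved, the other one that complements are.

  Regular ideals of \<open>C(X)\<close> correspond to regular open sets: by complete regularity
  \<open>V \<mapsto> {f. f = 0 off V}\<close> is an isomorphism from \<open>Ropen X\<close> to \<open>Rideal (C(X))\<close>, with inverse
  \<open>J \<mapsto> {x. \<exists>f\<in>J. f x \<noteq> 0}\<close>. Under this correspondence \<open>J \<mapsto> \<alpha>(J)\<^sup>\<bottom>\<^sup>\<bottom>\<close> becomes
  \<open>V \<mapsto> int (cl (\<pi>\<^sup>-\<^sup>1 V))\<close> and \<open>K \<mapsto> \<alpha>\<^sup>-\<^sup>1(K)\<close> becomes \<open>\<pi>\<^sub>*\<close>.\<close>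

section \<open>Isomorphisms of Boolean algebras\<close>

lemma inverse_between_sym:
  "inverse_between A B h k \<Longrightarrow> inverse_between B A k h"
  by (auto simp: inverse_between_def)

lemma inverse_between_trans:
  "\<lbrakk>inverse_between A B h k; inverse_between B C h' k'\<rbrakk>
    \<Longrightarrow> inverse_between A C (h' \<circ> h) (k \<circ> k')"
  by (auto simp: inverse_between_def Pi_iff)

lemma inverse_between_cong:
  assumes "inverse_between A B h k"
    and "\<And>a. a \<in> A \<Longrightarrow> h a = h' a" and "\<And>b. b \<in> B \<Longrightarrow> k b = k' b"
  shows "inverse_between A B h' k'"
  using assms by (auto simp: inverse_between_def Pi_iff)

lemma inverse_between_bij_betw:
  "inverse_between A B h k \<Longrightarrow> bij_betw h A B"
  by (rule bij_betw_byWitness[where f' = k]) (auto simp: inverse_between_def)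

text \<open>Only \<open>A\<close> is assumed to be a Boolean algebra: \<open>h\<close> is onto and
  preserves the operations, so each axiom for \<open>B\<close> is the image of the same axiom for
  \<open>A\<close>. This is how \<open>Rideal (Cfun X)\<close> becomes a Boolean algebra.\<close>

lemma bool_alg_isoI:
  assumes A: "carrier_boolean_algebra A"
    and bij: "bij_betw h (carrier A) (carrier B)"
    and meet: "\<And>x y. \<lbrakk>x \<in> carrier A; y \<in> carrier A\<rbrakk> \<Longrightarrow> h (bmeet A x y) = bmeet B (h x) (h y)"
    and join: "\<And>x y. \<lbrakk>x \<in> carrier A; y \<in> carrier A\<rbrakk> \<Longrightarrow> h (bjoin A x y) = bjoin B (h x) (h y)"
    and compl: "\<And>x. x \<in> carrier A \<Longrightarrow> h (bcompl A x) = bcompl B (h x)"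
    and zero: "h (bzero A) = bzero B" and one: "h (bone A) = bone B"
  shows "bool_alg_iso A B h"
proof -
  interpret A: carrier_boolean_algebra A by fact
  have B: "carrier B = h ` carrier A"
    using bij by (simp add: bij_betw_def)
  note hom = meet[symmetric] join[symmetric] compl[symmetric] zero[symmetric] one[symmetric]
  have "carrier_boolean_algebra B"
  proof
    fix x y z assume xyz: "x \<in> carrier B" "y \<in> carrier B" "z \<in> carrier B"
    then obtain a b c where abc: "a \<in> carrier A" "b \<in> carrier A" "c \<in> carrier A"
      and eq: "x = h a" "y = h b" "z = h c"
      unfolding B by blast
    note closed = A.meet_closed A.join_closed
    show "bmeet B (bmeet B x y) z = bmeet B x (bmeet B y z)"
      using abc by (simp add: eq hom closed A.meet_assoc)
    show "bjoin B (bjoin B x y) z = bjoin B x (bjoin B y z)"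
      using abc by (simp add: eq hom closed A.join_assoc)
    show "bmeet B x (bjoin B y z) = bjoin B (bmeet B x y) (bmeet B x z)"
      using abc by (simp add: eq hom closed A.meet_join_distrib)
    show "bjoin B x (bmeet B y z) = bmeet B (bjoin B x y) (bjoin B x z)"
      using abc by (simp add: eq hom closed A.join_meet_distrib)
  next
    fix x y assume xy: "x \<in> carrier B" "y \<in> carrier B"
    then obtain a b where ab: "a \<in> carrier A" "b \<in> carrier A" and eq: "x = h a" "y = h b"
      unfolding B by blast
    show "bmeet B x y \<in> carrier B"
      using ab by (simp add: eq hom B A.meet_closed)
    show "bjoin B x y \<in> carrier B"
      using ab by (simp add: eq hom B A.join_closed)
    show "bmeet B x y = bmeet B y x"
      using ab by (simp add: eq hom A.meet_commute)
    show "bjoin B x y = bjoin B y x"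
      using ab by (simp add: eq hom A.join_commute)
  next
    fix x assume x: "x \<in> carrier B"
    then obtain a where a: "a \<in> carrier A" and eq: "x = h a"
      unfolding B by blast
    show "bcompl B x \<in> carrier B"
      using a by (simp add: eq hom B A.compl_closed)
    show "bmeet B x (bone B) = x"
      using a by (simp add: eq hom A.one_closed A.meet_one)
    show "bjoin B x (bzero B) = x"
      using a by (simp add: eq hom A.zero_closed A.join_zero)
    show "bmeet B x (bcompl B x) = bzero B"
      using a by (simp add: eq hom A.compl_closed A.meet_compl)
    show "bjoin B x (bcompl B x) = bone B"
      using a by (simp add: eq hom A.compl_closed A.join_compl)
  qed (simp_all add: hom B A.zero_closed A.one_closed)
  then show ?thesis
    using assms by (auto simp: bool_alg_iso_def)
qed

lemma bool_alg_isoD: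
  assumes "bool_alg_iso A B h"
  shows "carrier_boolean_algebra A" "carrier_boolean_algebra B"
    and "bij_betw h (carrier A) (carrier B)"
    and "\<And>x y. \<lbrakk>x \<in> carrier A; y \<in> carrier A\<rbrakk> \<Longrightarrow> h (bmeet A x y) = bmeet B (h x) (h y)"
    and "\<And>x y. \<lbrakk>x \<in> carrier A; y \<in> carrier A\<rbrakk> \<Longrightarrow> h (bjoin A x y) = bjoin B (h x) (h y)"
    and "\<And>x. x \<in> carrier A \<Longrightarrow> h (bcompl A x) = bcompl B (h x)"
    and "h (bzero A) = bzero B" "h (bone A) = bone B"
  using assms by (simp_all add: bool_alg_iso_def)

lemma bool_alg_iso_trans:
  assumes f: "bool_alg_iso A B f" and g: "bool_alg_iso B C g"
  shows "bool_alg_iso A C (g \<circ> f)"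
proof (rule bool_alg_isoI)
  show "bij_betw (g \<circ> f) (carrier A) (carrier C)"
    by (rule bij_betw_trans[OF bool_alg_isoD(3)[OF f] bool_alg_isoD(3)[OF g]])
qed (simp_all add: bool_alg_isoD[OF f] bool_alg_isoD[OF g] bij_betw_apply[OF bool_alg_isoD(3)[OF f]])

lemma bool_alg_iso_inverse:
  assumes h: "bool_alg_iso A B h" and k: "inverse_between (carrier A) (carrier B) h k"
  shows "bool_alg_iso B A k"
proof -
  interpret A: carrier_boolean_algebra A
    by (rule bool_alg_isoD(1)[OF h])
  have kc: "k x \<in> carrier A" and hk: "h (k x) = x" if "x \<in> carrier B" for x
    using k that by (auto simp: inverse_between_def)
  \<comment> \<open>In this form the inverse property turns each law for \<open>k\<close> into the
    corresponding law for \<open>h\<close>.\<close>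
  have kI: "k b = a" if "h a = b" "a \<in> carrier A" for a b
    using k that by (auto simp: inverse_between_def)
  show ?thesis
  proof (rule bool_alg_isoI)
    show "bij_betw k (carrier B) (carrier A)"
      by (rule inverse_between_bij_betw[OF inverse_between_sym[OF k]])
  qed (rule kI bool_alg_isoD(2)[OF h]; simp add: kc hk bool_alg_isoD[OF h] A.meet_closed
      A.join_closed A.compl_closed A.zero_closed A.one_closed)+
qed

text \<open>The maps in the theorem are compared with more convenient ones on the carrier only;
  closure of the carrier under the operations makes this enough.\<close>

lemma bool_alg_iso_cong:
  assumes h: "bool_alg_iso A B h" and eq: "\<And>x. x \<in> carrier A \<Longrightarrow> h x = h' x"
  shows "bool_alg_iso A B h'"
proof -
  interpret A: carrier_boolean_algebra A
    by (rule bool_alg_isoD(1)[OF h])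
  have eq': "h' x = h x" if "x \<in> carrier A" for x
    using eq that by simp
  have "bij_betw h' (carrier A) (carrier B)"
    using bool_alg_isoD(3)[OF h] by (simp add: eq' cong: bij_betw_cong)
  then show ?thesis
    by (intro bool_alg_isoI)
      (simp_all add: bool_alg_isoD[OF h] eq' A.meet_closed A.join_closed A.compl_closed
        A.zero_closed A.one_closed)
qed


section \<open>Regular open sets\<close>

abbreviation int_cl :: "'a topology \<Rightarrow> 'a set \<Rightarrow> 'a set" where
  "int_cl X A \<equiv> X interior_of (X closure_of A)"

abbreviation exterior :: "'a topology \<Rightarrow> 'a set \<Rightarrow> 'a set" where
  "exterior X A \<equiv> topspace X - X closure_of A"

text \<open>On open sets \<open>exterior X\<close> is the pseudocomplement, so regularisation is
  double negation.\<close>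

lemma int_cl_eq_exterior: "int_cl X A = exterior X (exterior X A)"
  by (simp add: interior_of_closure_of)

lemma subset_int_cl: "openin X A \<Longrightarrow> A \<subseteq> int_cl X A"
  by (simp add: closure_of_subset interior_of_maximal openin_subset)

lemma closure_of_int_cl:
  assumes "openin X A" shows "X closure_of int_cl X A = X closure_of A"
proof (rule antisym)
  show "X closure_of int_cl X A \<subseteq> X closure_of A"
    by (rule closure_of_minimal[OF interior_of_subset closedin_closure_of])
  show "X closure_of A \<subseteq> X closure_of int_cl X A"
    by (rule closure_of_mono[OF subset_int_cl[OF assms]])
qed

lemma exterior_int_cl: "openin X A \<Longrightarrow> exterior X (int_cl X A) = exterior X A"
  by (simp add: closure_of_int_cl)

text \<open>Triple negation collapses to a single one.\<close>

lemma int_cl_exterior: "openin X A \<Longrightarrow> int_cl X (exterior X A) = exterior X A"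
  using int_cl_eq_exterior[of X "exterior X A"] exterior_int_cl[of X A]
  unfolding int_cl_eq_exterior[of X A] by (rule trans)

lemma openin_exterior: "openin X (exterior X A)"
  by (rule openin_diff[OF openin_topspace closedin_closure_of])

lemma disjoint_exterior:
  assumes "openin X A" shows "A \<inter> B = {} \<longleftrightarrow> A \<subseteq> exterior X B"
  using openin_subset[OF assms] openin_Int_closure_of_eq_empty[OF assms, of B] by blast

lemma int_cl_interior_of_closedin:
  assumes "closedin X C" shows "int_cl X (X interior_of C) = X interior_of C"
proof (rule antisym)
  show "int_cl X (X interior_of C) \<subseteq> X interior_of C"
    by (rule interior_of_mono[OF closure_of_minimal[OF interior_of_subset assms]])
  show "X interior_of C \<subseteq> int_cl X (X interior_of C)"
    by (rule subset_int_cl[OF openin_interior_of])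
qed

lemma int_cl_idem: "int_cl X (int_cl X A) = int_cl X A"
  by (rule int_cl_interior_of_closedin[OF closedin_closure_of])

text \<open>For open \<open>O\<close> one has
  \<open>O \<inter> cl B \<subseteq> cl (O \<inter> B)\<close>. Using this once with
  \<open>int_cl X A\<close> and once with \<open>B\<close> puts the right side inside
  \<open>cl (A \<inter> B)\<close>; being open, it lies in the interior.\<close>

lemma int_cl_Int:
  assumes A: "openin X A" and B: "openin X B"
  shows "int_cl X (A \<inter> B) = int_cl X A \<inter> int_cl X B"
proof
  show "int_cl X (A \<inter> B) \<subseteq> int_cl X A \<inter> int_cl X B"
    by (simp add: closure_of_mono interior_of_mono)
  have "int_cl X A \<inter> int_cl X B \<subseteq> X closure_of (int_cl X A \<inter> B)"
    using openin_Int_closure_of_subset[of X "int_cl X A" B] interior_of_subset[of X "X closure_of B"]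
    by auto
  also have "int_cl X A \<inter> B \<subseteq> X closure_of (A \<inter> B)"
    using openin_Int_closure_of_subset[OF B, of A] interior_of_subset[of X "X closure_of A"]
    by (auto simp: Int_commute)
  then have "X closure_of (int_cl X A \<inter> B) \<subseteq> X closure_of (A \<inter> B)"
    by (simp add: closure_of_minimal)
  finally show "int_cl X A \<inter> int_cl X B \<subseteq> int_cl X (A \<inter> B)"
    by (simp add: interior_of_maximal openin_Int)
qed

lemma int_cl_Un_int_cl:
  "openin X A \<Longrightarrow> int_cl X (int_cl X A \<union> B) = int_cl X (A \<union> B)"
  by (simp add: closure_of_int_cl)

section \<open>The Boolean algebra of regular open sets\<close>

lemma carrier_Ropen: "V \<in> carrier (Ropen X) \<longleftrightarrow> openin X V \<and> int_cl X V = V"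
  by (auto simp: Ropen_def)

lemma exterior_in_Ropen: "openin X A \<Longrightarrow> exterior X A \<in> carrier (Ropen X)"
  by (simp add: carrier_Ropen int_cl_exterior openin_exterior)

lemma int_cl_in_Ropen: "int_cl X A \<in> carrier (Ropen X)"
  by (simp add: carrier_Ropen int_cl_idem)

lemma Ropen_simps:
  "bmeet (Ropen X) = (\<lambda>V W. V \<inter> W)" "bjoin (Ropen X) = (\<lambda>V W. int_cl X (V \<union> W))"
  "bcompl (Ropen X) = exterior X" "bzero (Ropen X) = {}" "bone (Ropen X) = topspace X"
  by (simp_all add: Ropen_def)

text \<open>De Morgan: joins are expressible by meets and complements.\<close>

lemma Ropen_join_eq:
  "int_cl X (V \<union> W) = exterior X (exterior X V \<inter> exterior X W)"
  by (simp only: int_cl_eq_exterior) (simp only: closure_of_Un Diff_Un)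

lemma carrier_boolean_algebra_Ropen: "carrier_boolean_algebra (Ropen X)"
proof
  fix U V W assume "U \<in> carrier (Ropen X)" "V \<in> carrier (Ropen X)" "W \<in> carrier (Ropen X)"
  then have U: "openin X U" "int_cl X U = U" and V: "openin X V" "int_cl X V = V"
    and W: "openin X W" "int_cl X W = W"
    by (auto simp: carrier_Ropen)
  \<comment> \<open>Both bracketings reduce to the regularised union of all three sets.\<close>
  have "int_cl X (int_cl X (U \<union> V) \<union> W) = int_cl X (U \<union> V \<union> W)"
    using U V by (simp only: int_cl_Un_int_cl openin_Un)
  also have "\<dots> = int_cl X (int_cl X (V \<union> W) \<union> U)"
    using V W by (simp only: int_cl_Un_int_cl openin_Un) (simp add: Un_ac)
  finally show "bjoin (Ropen X) (bjoin (Ropen X) U V) W = bjoin (Ropen X) U (bjoin (Ropen X) V W)"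
    by (simp add: Ropen_simps Un_ac)
  have "U \<inter> int_cl X (V \<union> W) = int_cl X (U \<inter> (V \<union> W))"
    using U V W by (simp only: int_cl_Int openin_Un)
  then show "bmeet (Ropen X) U (bjoin (Ropen X) V W)
      = bjoin (Ropen X) (bmeet (Ropen X) U V) (bmeet (Ropen X) U W)"
    by (simp only: Ropen_simps Int_Un_distrib)
  show "bjoin (Ropen X) U (bmeet (Ropen X) V W)
      = bmeet (Ropen X) (bjoin (Ropen X) U V) (bjoin (Ropen X) U W)"
    using U V W by (simp only: Ropen_simps Un_Int_distrib int_cl_Int openin_Un)
next
  fix U assume "U \<in> carrier (Ropen X)"
  then have U: "openin X U" "int_cl X U = U"
    by (auto simp: carrier_Ropen)
  have sub: "U \<subseteq> X closure_of U"
    by (simp add: closure_of_subset openin_subset U)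
  then show "bmeet (Ropen X) U (bcompl (Ropen X) U) = bzero (Ropen X)"
    by (auto simp: Ropen_simps)
  \<comment> \<open>By De Morgan, \<open>U\<close> joined with its complement is the exterior of
    this set, hence the whole space.\<close>
  have "exterior X U \<inter> exterior X (exterior X U) = {}"
    using U by (simp flip: int_cl_eq_exterior) (use sub in auto)
  then show "bjoin (Ropen X) U (bcompl (Ropen X) U) = bone (Ropen X)"
    by (simp only: Ropen_simps Ropen_join_eq) simp
  show "bmeet (Ropen X) U (bone (Ropen X)) = U"
    using openin_subset[OF U(1)] by (auto simp: Ropen_simps)
qed (auto simp: Ropen_simps int_cl_exterior int_cl_idem Int_ac Un_ac carrier_Ropen
      int_cl_Int openin_exterior simp del: closure_of_Un)

text \<open>Joins follow by De Morgan, and bottom is the complement of top.\<close>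

lemma bool_alg_iso_RopenI:
  assumes inv: "inverse_between (carrier (Ropen X)) (carrier (Ropen Y)) h k"
    and meet: "\<And>U V. \<lbrakk>U \<in> carrier (Ropen X); V \<in> carrier (Ropen X)\<rbrakk> \<Longrightarrow> h (U \<inter> V) = h U \<inter> h V"
    and compl: "\<And>U. U \<in> carrier (Ropen X) \<Longrightarrow> h (exterior X U) = exterior Y (h U)"
    and top: "h (topspace X) = topspace Y"
  shows "bool_alg_iso (Ropen X) (Ropen Y) h"
proof (rule bool_alg_isoI)
  interpret X: carrier_boolean_algebra "Ropen X"
    by (rule carrier_boolean_algebra_Ropen)
  note closed = X.compl_closed[unfolded Ropen_simps] X.meet_closed[unfolded Ropen_simps]
  show "h (bjoin (Ropen X) U V) = bjoin (Ropen Y) (h U) (h V)"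
    if "U \<in> carrier (Ropen X)" "V \<in> carrier (Ropen X)" for U V
    using that by (simp only: Ropen_simps Ropen_join_eq meet compl closed)
  have "h (exterior X (topspace X)) = exterior Y (topspace Y)"
    using X.one_closed by (simp only: compl top Ropen_simps)
  then show "h (bzero (Ropen X)) = bzero (Ropen Y)"
    by (simp add: Ropen_simps)
qed (use assms in \<open>simp_all add: carrier_boolean_algebra_Ropen inverse_between_bij_betw Ropen_simps\<close>)


section \<open>Irreducible maps\<close>

text \<open>Closedness of \<open>\<pi>\<close> is the form in which compactness of \<open>Y\<close>
  and the Hausdorff property of \<open>X\<close> enter this section.\<close>

locale irreducible_closed_map =
  fixes Y :: "'b topology" and X :: "'a topology" and \<pi> :: "'b \<Rightarrow> 'a"
  assumes irred: "irreducible_map Y X \<pi>" and closed: "closed_map Y X \<pi>"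
begin

abbreviation push :: "'b set \<Rightarrow> 'a set" where
  "push U \<equiv> topspace X - \<pi> ` (topspace Y - U)"

abbreviation pull :: "'a set \<Rightarrow> 'b set" where
  "pull V \<equiv> {y \<in> topspace Y. \<pi> y \<in> V}"

lemma cont: "continuous_map Y X \<pi>" and surj: "\<pi> ` topspace Y = topspace X"
  using irred by (auto simp: irreducible_map_def)

lemma openin_push: "openin Y U \<Longrightarrow> openin X (push U)"
  using closed by (auto simp: closed_map_def intro!: openin_diff)

lemma openin_pull: "openin X V \<Longrightarrow> openin Y (pull V)"
  using cont by (auto simp: continuous_map_def)

text \<open>\<open>push\<close> is right adjoint to \<open>pull\<close>.\<close>

lemma subset_push_iff: "V \<subseteq> topspace X \<Longrightarrow> V \<subseteq> push U \<longleftrightarrow> pull V \<subseteq> U"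
  by auto

lemma pull_eq_empty_iff: "V \<subseteq> topspace X \<Longrightarrow> pull V = {} \<longleftrightarrow> V = {}"
  unfolding surj[symmetric] by blast

text \<open>Irreducibility in terms of open sets: \<open>push U\<close> is empty exactly when the
  closed set \<open>topspace Y - U\<close> maps onto \<open>X\<close>.\<close>

lemma push_eq_empty_iff:
  assumes "openin Y U" shows "push U = {} \<longleftrightarrow> U = {}"
proof
  assume "push U = {}"
  then have "\<pi> ` (topspace Y - U) = topspace X"
    using surj by auto
  moreover have "closedin Y (topspace Y - U)"
    using assms by blast
  ultimately have "topspace Y - U = topspace Y"
    using irred unfolding irreducible_map_def by blast
  then show "U = {}"
    using openin_subset[OF assms] by auto
qed (use surj in auto)

text \<open>The part \<open>W\<close> of \<open>U\<close> outside the closure is open, and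
  \<open>pull (push W)\<close> lies both in \<open>W\<close> and in \<open>pull (push U)\<close>, so
  it is empty. Surjectivity then gives \<open>push W = {}\<close>, and irreducibility gives
  \<open>W = {}\<close>.\<close>

lemma closure_pull_push:
  assumes U: "openin Y U"
  shows "Y closure_of pull (push U) = Y closure_of U"
proof (rule antisym)
  show "Y closure_of pull (push U) \<subseteq> Y closure_of U"
    by (rule closure_of_mono) auto
  define W where "W = U - Y closure_of pull (push U)"
  have W: "openin Y W"
    unfolding W_def by (simp add: U openin_diff)
  have "pull (push W) \<subseteq> W" "pull (push W) \<subseteq> pull (push U)"
    unfolding W_def by auto
  moreover have "pull (push U) \<subseteq> Y closure_of pull (push U)"
    by (rule closure_of_subset) auto
  ultimately have "pull (push W) = {}"
    unfolding W_def by blast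
  then have "push W = {}"
    using pull_eq_empty_iff[of "push W"] by blast
  then have "W = {}"
    using push_eq_empty_iff[OF W] by blast
  then have "U \<subseteq> Y closure_of pull (push U)"
    by (auto simp: W_def)
  then show "Y closure_of U \<subseteq> Y closure_of pull (push U)"
    by (simp add: closure_of_minimal)
qed

lemma interior_image_closure_eq_exterior:
  "X interior_of (\<pi> ` (Y closure_of U)) = exterior X (push (exterior Y U))"
proof -
  have "topspace Y - exterior Y U = Y closure_of U"
    using closure_of_subset_topspace[of Y U] by blast
  then show ?thesis
    by (simp only: interior_of_closure_of)
qed

text \<open>Disjoint sets have disjoint pushes because \<open>\<pi>\<close> is onto, which gives one
  inclusion. For the other, density of \<open>pull (push (exterior Y U))\<close> in
  \<open>exterior Y U\<close> forces the preimage of the interior into \<open>cl U\<close>, hence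
  into \<open>U\<close> by regularity.\<close>

lemma interior_image_closure_eq_push:
  assumes "U \<in> carrier (Ropen Y)"
  shows "X interior_of (\<pi> ` (Y closure_of U)) = push U"
proof
  have U: "openin Y U" "int_cl Y U = U"
    using assms by (auto simp: carrier_Ropen)
  let ?V = "X interior_of (\<pi> ` (Y closure_of U))"
  have "U \<inter> exterior Y U = {}"
    using closure_of_subset[OF openin_subset[OF U(1)]] by auto
  then have "push U \<inter> push (exterior Y U) = {}"
    unfolding surj[symmetric] by blast
  then show "push U \<subseteq> ?V"
    using disjoint_exterior[OF openin_push[OF U(1)], of "push (exterior Y U)"]
    by (simp add: interior_image_closure_eq_exterior)
  have "push (exterior Y U) \<subseteq> X closure_of push (exterior Y U)"
    by (rule closure_of_subset) auto
  then have "pull ?V \<inter> pull (push (exterior Y U)) = {}"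
    by (auto simp: interior_image_closure_eq_exterior)
  moreover have V: "openin Y (pull ?V)"
    by (rule openin_pull[OF openin_interior_of])
  \<comment> \<open>An open set disjoint from a set is disjoint from its closure; this passes from
    the dense subset to all of \<open>exterior Y U\<close>.\<close>
  ultimately have "pull ?V \<inter> Y closure_of pull (push (exterior Y U)) = {}"
    by (simp only: openin_Int_closure_of_eq_empty)
  then have "pull ?V \<inter> exterior Y U = {}"
    by (simp only: closure_pull_push openin_exterior openin_Int_closure_of_eq_empty[OF V])
  then have "pull ?V \<subseteq> Y closure_of U"
    by blast
  then have "pull ?V \<subseteq> U"
    using interior_of_maximal[OF _ V] U(2) by blast
  then show "?V \<subseteq> push U"
    by (simp add: subset_push_iff interior_of_subset_topspace)
qed

text \<open>Equating the two descriptions of the map shows how \<open>push\<close> interacts with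
  complements.\<close>

lemma push_eq_exterior:
  "U \<in> carrier (Ropen Y) \<Longrightarrow> push U = exterior X (push (exterior Y U))"
  using interior_image_closure_eq_push interior_image_closure_eq_exterior by (rule trans[OF sym])

lemma push_in_Ropen:
  assumes "U \<in> carrier (Ropen Y)" shows "push U \<in> carrier (Ropen X)"
  unfolding push_eq_exterior[OF assms] by (intro exterior_in_Ropen openin_push openin_exterior)

lemma int_cl_pull_push: "U \<in> carrier (Ropen Y) \<Longrightarrow> int_cl Y (pull (push U)) = U"
  by (simp only: carrier_Ropen closure_pull_push)

text \<open>Continuity gives \<open>\<pi> (cl (pull V)) \<subseteq> cl V\<close>, and
  \<open>V\<close> is regular; the converse is the adjunction.\<close>

lemma push_int_cl_pull:
  assumes "V \<in> carrier (Ropen X)"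
  shows "push (int_cl Y (pull V)) = V"
proof
  have V: "openin X V" "int_cl X V = V"
    using assms by (auto simp: carrier_Ropen)
  have "push (int_cl Y (pull V)) = X interior_of (\<pi> ` (Y closure_of pull V))"
    using interior_image_closure_eq_push[OF int_cl_in_Ropen, of "pull V"]
    by (simp add: closure_of_int_cl openin_pull V)
  also have "\<pi> ` (Y closure_of pull V) \<subseteq> X closure_of (\<pi> ` pull V)"
    using cont by (auto simp: continuous_map_eq_image_closure_subset)
  also have "\<dots> \<subseteq> X closure_of V"
    by (rule closure_of_mono) auto
  finally show "push (int_cl Y (pull V)) \<subseteq> V"
    using V by (simp add: interior_of_mono)
  show "V \<subseteq> push (int_cl Y (pull V))"
    using V by (simp add: subset_push_iff openin_subset subset_int_cl openin_pull)
qed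

lemma inverse_between_push_pull:
  "inverse_between (carrier (Ropen Y)) (carrier (Ropen X)) push (\<lambda>V. int_cl Y (pull V))"
  unfolding inverse_between_def
  using push_in_Ropen int_cl_in_Ropen int_cl_pull_push push_int_cl_pull by blast

lemma bool_alg_iso_push: "bool_alg_iso (Ropen Y) (Ropen X) push"
proof (rule bool_alg_iso_RopenI[OF inverse_between_push_pull])
  show "push (exterior Y U) = exterior X (push U)" if U: "U \<in> carrier (Ropen Y)" for U
  proof -
    have "exterior Y U \<in> carrier (Ropen Y)"
      using U by (intro exterior_in_Ropen) (simp add: carrier_Ropen)
    then have "push (exterior Y U) = exterior X (push (exterior Y (exterior Y U)))"
      by (rule push_eq_exterior)
    also have "exterior Y (exterior Y U) = U"
      using U by (simp add: carrier_Ropen flip: int_cl_eq_exterior)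
    finally show ?thesis .
  qed
\<comment> \<open>Meets and top are preserved already as plain set identities.\<close>
qed auto

end


section \<open>Regular ideals of continuous functions\<close>

definition cozero_set :: "'a topology \<Rightarrow> ('a \<Rightarrow> complex) set \<Rightarrow> 'a set" where
  "cozero_set X S = {x \<in> topspace X. \<exists>f\<in>S. f x \<noteq> 0}"

definition vanishing_off :: "'a topology \<Rightarrow> 'a set \<Rightarrow> ('a \<Rightarrow> complex) set" where
  "vanishing_off X V = {f \<in> carrier (Cfun X). \<forall>x\<in>topspace X - V. f x = 0}"

lemma (in cring) ideal_annihilator:
  assumes "S \<subseteq> carrier R"
  shows "ideal (annihilator R S) R"
proof (rule idealI[OF ring_axioms])
  have S: "g \<in> carrier R" if "g \<in> S" for g
    using assms that by blast
  show "subgroup (annihilator R S) (add_monoid R)"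
    by (rule add.subgroupI) (auto simp: annihilator_def S l_distr l_minus)
  fix a x assume "a \<in> annihilator R S" "x \<in> carrier R"
  then show "x \<otimes> a \<in> annihilator R S" "a \<otimes> x \<in> annihilator R S"
    by (auto simp: annihilator_def S m_assoc m_comm[of a x])
qed

lemma openin_cozero_set:
  assumes "S \<subseteq> carrier (Cfun X)"
  shows "openin X (cozero_set X S)"
proof -
  have "openin X {x \<in> topspace X. f x \<in> - {0}}" if "f \<in> S" for f
    using that assms by (intro openin_continuous_map_preimage[where Y = euclidean])
      (auto simp: Cfun_def)
  then have "openin X (\<Union>f\<in>S. {x \<in> topspace X. f x \<in> - {0}})"
    by blast
  also have "(\<Union>f\<in>S. {x \<in> topspace X. f x \<in> - {0}}) = cozero_set X S"
    by (auto simp: cozero_set_def)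
  finally show ?thesis .
qed

lemma vanishing_off_subset: "vanishing_off X V \<subseteq> carrier (Cfun X)"
  by (auto simp: vanishing_off_def)

lemma vanishing_off_Int: "vanishing_off X (V \<inter> W) = vanishing_off X V \<inter> vanishing_off X W"
  by (auto simp: vanishing_off_def)

lemma cozero_set_Un: "cozero_set X (S \<union> T) = cozero_set X S \<union> cozero_set X T"
  by (auto simp: cozero_set_def)

text \<open>Two complex functions have product zero iff their cozero sets are disjoint. As the
  cozero set of \<open>f\<close> is open, disjointness from that of \<open>S\<close> means lying in
  its exterior.\<close>

lemma annihilator_Cfun:
  assumes S: "S \<subseteq> carrier (Cfun X)"
  shows "annihilator (Cfun X) S = vanishing_off X (exterior X (cozero_set X S))"
proof -
  have "f \<in> annihilator (Cfun X) S \<longleftrightarrow> f \<in> vanishing_off X (exterior X (cozero_set X S))"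
    if f: "f \<in> carrier (Cfun X)" for f
  proof -
    have "f \<in> annihilator (Cfun X) S \<longleftrightarrow> cozero_set X {f} \<inter> cozero_set X S = {}"
      using f by (auto simp: annihilator_def Cfun_def cozero_set_def fun_eq_iff)
    also have "\<dots> \<longleftrightarrow> cozero_set X {f} \<subseteq> exterior X (cozero_set X S)"
      using f by (intro disjoint_exterior openin_cozero_set) (auto simp: cozero_set_def)
    also have "\<dots> \<longleftrightarrow> f \<in> vanishing_off X (exterior X (cozero_set X S))"
      using f by (auto simp: cozero_set_def vanishing_off_def)
    finally show ?thesis .
  qed
  then show ?thesis
    by (auto simp: annihilator_def vanishing_off_def)
qed

lemma cozero_set_vanishing_off:
  assumes X: "completely_regular_space X" and V: "openin X V"
  shows "cozero_set X (vanishing_off X V) = V"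
proof
  show "cozero_set X (vanishing_off X V) \<subseteq> V"
    by (auto simp: cozero_set_def vanishing_off_def)
  show "V \<subseteq> cozero_set X (vanishing_off X V)"
  proof
    fix x assume x: "x \<in> V"
    then have xX: "x \<in> topspace X"
      using openin_subset[OF V] by auto
    then obtain f :: "'a \<Rightarrow> real" where f: "continuous_map X (top_of_set {0..1}) f"
      "f x = 0" "f ` (topspace X - V) \<subseteq> {1}"
      using X V x unfolding completely_regular_space_def
      by (metis DiffD2 DiffI closedin_topspace closedin_diff)
    \<comment> \<open>The separating function is 0 at \<open>x\<close> and 1 off \<open>V\<close>,
      so it is flipped to vanish off \<open>V\<close>.\<close>
    define g where "g = (\<lambda>z\<in>topspace X. complex_of_real (1 - f z))"
    have "continuous_map X euclideanreal f"
      using f(1) by (simp add: continuous_map_in_subtopology)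
    then have "continuous_map X euclideanreal (\<lambda>z. 1 - f z)"
      by (intro continuous_map_diff) auto
    then have "continuous_map X euclidean (complex_of_real \<circ> (\<lambda>z. 1 - f z))"
      by (rule continuous_map_compose) (auto intro!: continuous_intros)
    then have "g \<in> carrier (Cfun X)"
      by (simp add: Cfun_def g_def continuous_map_restrict_topspace o_def)
    then have "g \<in> vanishing_off X V" "g x \<noteq> 0"
      using f xX by (auto simp: vanishing_off_def g_def image_subset_iff)
    then show "x \<in> cozero_set X (vanishing_off X V)"
      using xX by (auto simp: cozero_set_def)
  qed
qed

locale completely_regular =
  fixes X :: "'a topology"
  assumes X: "completely_regular_space X"
begin

lemma annihilator_vanishing_off:
  "openin X V \<Longrightarrow> annihilator (Cfun X) (vanishing_off X V) = vanishing_off X (exterior X V)"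
  by (simp add: annihilator_Cfun vanishing_off_subset cozero_set_vanishing_off X)

text \<open>Stated for arbitrary subsets, since it is applied to unions of ideals and to images
  under \<open>\<alpha>\<close>.\<close>

lemma double_annihilator:
  assumes "S \<subseteq> carrier (Cfun X)"
  shows "annihilator (Cfun X) (annihilator (Cfun X) S)
    = vanishing_off X (int_cl X (cozero_set X S))"
  by (simp only: annihilator_Cfun[OF assms] annihilator_vanishing_off openin_exterior
      int_cl_eq_exterior)

text \<open>Every annihilator in a commutative ring is an ideal, so regular ideals are the fixed
  points of the double annihilator.\<close>

lemma regular_ideal_iff:
  "J \<in> carrier (Rideal (Cfun X)) \<longleftrightarrow>
    J \<subseteq> carrier (Cfun X) \<and> J = vanishing_off X (int_cl X (cozero_set X J))"
proof -
  interpret cring "Cfun X" by (rule cring_Cfun)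
  have "J \<in> carrier (Rideal (Cfun X)) \<longleftrightarrow>
    J \<subseteq> carrier (Cfun X) \<and> J = annihilator (Cfun X) (annihilator (Cfun X) J)"
    using ideal_annihilator[of "annihilator (Cfun X) J"]
    by (auto simp: Rideal_def annihilator_def dest: ideal.Icarr)
  then show ?thesis
    using double_annihilator by auto
qed

lemma inverse_between_vanishing_off:
  "inverse_between (carrier (Ropen X)) (carrier (Rideal (Cfun X)))
    (vanishing_off X) (cozero_set X)"
  unfolding inverse_between_def
proof (intro conjI funcsetI ballI)
  fix V assume "V \<in> carrier (Ropen X)"
  then show "cozero_set X (vanishing_off X V) = V"
    and "vanishing_off X V \<in> carrier (Rideal (Cfun X))"
    by (simp_all add: regular_ideal_iff vanishing_off_subset carrier_Ropen
        cozero_set_vanishing_off X)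
next
  fix J assume "J \<in> carrier (Rideal (Cfun X))"
  then have J: "J = vanishing_off X (int_cl X (cozero_set X J))"
    by (simp add: regular_ideal_iff)
  \<comment> \<open>Apply \<open>cozero_set X\<close> to both sides of the formula for
    \<open>J\<close>.\<close>
  then have "cozero_set X J = int_cl X (cozero_set X J)"
    by (metis cozero_set_vanishing_off X openin_interior_of)
  then show "vanishing_off X (cozero_set X J) = J" "cozero_set X J \<in> carrier (Ropen X)"
    using J int_cl_in_Ropen by metis+
qed

lemma bool_alg_iso_vanishing_off: "bool_alg_iso (Ropen X) (Rideal (Cfun X)) (vanishing_off X)"
proof (rule bool_alg_isoI)
  show "vanishing_off X (bjoin (Ropen X) V W)
      = bjoin (Rideal (Cfun X)) (vanishing_off X V) (vanishing_off X W)"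
    if "V \<in> carrier (Ropen X)" "W \<in> carrier (Ropen X)" for V W
    using that
    by (simp add: Rideal_def Ropen_simps double_annihilator vanishing_off_subset cozero_set_Un
        cozero_set_vanishing_off X carrier_Ropen)
  show "vanishing_off X (bzero (Ropen X)) = bzero (Rideal (Cfun X))"
    by (auto simp: vanishing_off_def Rideal_def Ropen_simps Cfun_def extensional_def fun_eq_iff
        continuous_map_restrict_topspace)
  show "vanishing_off X (bone (Ropen X)) = bone (Rideal (Cfun X))"
    by (simp add: vanishing_off_def Rideal_def Ropen_simps)
  show "bij_betw (vanishing_off X) (carrier (Ropen X)) (carrier (Rideal (Cfun X)))"
    by (rule inverse_between_bij_betw[OF inverse_between_vanishing_off])
qed (simp_all add: carrier_boolean_algebra_Ropen Rideal_def Ropen_simps vanishing_off_Int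
      annihilator_vanishing_off carrier_Ropen)

end

section \<open>The dual map on regular ideals\<close>

lemma cozero_set_dual_map:
  "continuous_map Y X \<pi> \<Longrightarrow>
    cozero_set Y (dual_map Y \<pi> ` J) = {y \<in> topspace Y. \<pi> y \<in> cozero_set X J}"
  by (auto simp: cozero_set_def dual_map_def continuous_map_def Pi_iff)

text \<open>\<open>f \<circ> \<pi>\<close> vanishes off \<open>U\<close> iff \<open>f\<close>
  vanishes on \<open>\<pi> (Y - U)\<close>, the complement of \<open>push U\<close>.\<close>

lemma (in irreducible_closed_map) dual_map_vimage_vanishing_off:
  "{f \<in> carrier (Cfun X). dual_map Y \<pi> f \<in> vanishing_off Y U} = vanishing_off X (push U)"
proof -
  have "dual_map Y \<pi> f \<in> carrier (Cfun Y)" if "f \<in> carrier (Cfun X)" for f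
    using dual_map_ring_hom[OF cont] that by (rule ring_hom_closed)
  moreover have "topspace X - push U = \<pi> ` (topspace Y - U)"
    using surj by auto
  ultimately show ?thesis
    by (auto simp: vanishing_off_def dual_map_def)
qed


theorem theorem1p1:
  fixes X :: "'a topology" and Y :: "'b topology" and \<pi> :: "'b \<Rightarrow> 'a"
    and \<alpha> :: "('a \<Rightarrow> complex) \<Rightarrow> ('b \<Rightarrow> complex)"
  assumes "compact_space X" and "Hausdorff_space X"
    and "compact_space Y" and "Hausdorff_space Y"
    and "irreducible_map Y X \<pi>"
    and "\<alpha> = dual_map Y \<pi>"
  shows
    "(bool_alg_iso (Ropen Y) (Ropen X) (\<lambda>U. X interior_of (\<pi> ` (Y closure_of U))) \<and>
      inverse_between (carrier (Ropen Y)) (carrier (Ropen X))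
        (\<lambda>U. X interior_of (\<pi> ` (Y closure_of U)))
        (\<lambda>V. Y interior_of (Y closure_of {y \<in> topspace Y. \<pi> y \<in> V}))) \<and>
     (bool_alg_iso (Rideal (Cfun X)) (Rideal (Cfun Y))
        (\<lambda>J. annihilator (Cfun Y) (annihilator (Cfun Y) (\<alpha> ` J))) \<and>
      inverse_between (carrier (Rideal (Cfun X))) (carrier (Rideal (Cfun Y)))
        (\<lambda>J. annihilator (Cfun Y) (annihilator (Cfun Y) (\<alpha> ` J)))
        (\<lambda>K. {f \<in> carrier (Cfun X). \<alpha> f \<in> K}))"
proof -
  have pi: "continuous_map Y X \<pi>"
    using assms(5) by (simp add: irreducible_map_def)
  interpret irreducible_closed_map Y X \<pi>
    using assms continuous_imp_closed_map[OF pi] by unfold_locales auto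
  interpret X: completely_regular X
    using assms by unfold_locales (simp add: compact_imp_locally_compact_space
          locally_compact_regular_imp_completely_regular_space)
  interpret Y: completely_regular Y
    using assms by unfold_locales (simp add: compact_imp_locally_compact_space
          locally_compact_regular_imp_completely_regular_space)
  let ?\<psi> = "\<lambda>V. int_cl Y (pull V)"
  let ?A = "\<lambda>J. annihilator (Cfun Y) (annihilator (Cfun Y) (\<alpha> ` J))"
  let ?B = "\<lambda>K. {f \<in> carrier (Cfun X). \<alpha> f \<in> K}"
  have A: "(vanishing_off Y \<circ> (?\<psi> \<circ> cozero_set X)) J = ?A J"
    if "J \<in> carrier (Rideal (Cfun X))" for J
  proof -
    have "\<alpha> ` J \<subseteq> carrier (Cfun Y)"
      using that ring_hom_closed[OF dual_map_ring_hom[OF pi]] assms(6)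
      by (auto simp: X.regular_ideal_iff)
    then show ?thesis
      by (simp add: Y.double_annihilator cozero_set_dual_map[OF pi] assms(6))
  qed
  \<comment> \<open>A regular ideal \<open>K\<close> is
    \<open>vanishing_off Y (cozero_set Y K)\<close>, so its preimage under \<open>\<alpha>\<close>
    is computed by \<open>push\<close>.\<close>
  have B: "((vanishing_off X \<circ> push) \<circ> cozero_set Y) K = ?B K"
    if "K \<in> carrier (Rideal (Cfun Y))" for K
    using that Y.inverse_between_vanishing_off
      dual_map_vimage_vanishing_off[of "cozero_set Y K"] assms(6)
    by (simp add: inverse_between_def)
  note X_sym = inverse_between_sym[OF X.inverse_between_vanishing_off]
    and push_sym = inverse_between_sym[OF inverse_between_push_pull]
  \<comment> \<open>Statement (2) is transported along \<open>Rideal (Cfun X)\<close>,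
    \<open>Ropen X\<close>, \<open>Ropen Y\<close>, \<open>Rideal (Cfun Y)\<close>; the middle map
    is the inverse of \<open>push\<close>.\<close>
  have "inverse_between (carrier (Rideal (Cfun X))) (carrier (Rideal (Cfun Y))) ?A ?B"
    by (rule inverse_between_cong[OF inverse_between_trans[OF
            inverse_between_trans[OF X_sym push_sym] Y.inverse_between_vanishing_off] A B])
  moreover have "bool_alg_iso (Rideal (Cfun X)) (Rideal (Cfun Y)) ?A"
    by (rule bool_alg_iso_cong[OF bool_alg_iso_trans[OF bool_alg_iso_trans[OF
            bool_alg_iso_inverse[OF X.bool_alg_iso_vanishing_off X.inverse_between_vanishing_off]
            bool_alg_iso_inverse[OF bool_alg_iso_push inverse_between_push_pull]]
          Y.bool_alg_iso_vanishing_off] A])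
  moreover have "bool_alg_iso (Ropen Y) (Ropen X) (\<lambda>U. X interior_of (\<pi> ` (Y closure_of U)))"
    using bool_alg_iso_push by (rule bool_alg_iso_cong) (simp only: interior_image_closure_eq_push)
  moreover have "inverse_between (carrier (Ropen Y)) (carrier (Ropen X))
      (\<lambda>U. X interior_of (\<pi> ` (Y closure_of U))) ?\<psi>"
    using inverse_between_push_pull
    by (rule inverse_between_cong) (simp_all only: interior_image_closure_eq_push)
  ultimately show ?thesis
    by blast
qed

end
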